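(* Let $B^H=(B^H_t)_{0\le t\le T}$ be a fractional Brownian motion with Hurst parameter $H\in(0,1)$, considered in its natural filtration. Its $L^2$ time-translation modulus is $$\omega_{B^H}(h)=Th^{2H}-\frac{2H}{2H+1}h^{2H+1},\qquad0<h\le T.$$ Moreover, $$[B^H]^2_{\rm tr}=\sup_{h>0}\frac{\omega_{B^H}(h)}{h}=\begin{cases}\infty,&0<H<\frac12,\\[0.5ex]T,&H=\frac12,\\[0.5ex]\dfrac{T^{2H}}{2H}\Big(1-\dfrac1{4H^2}\Big)^{2H-1},&H>\frac12.\end{cases}$$
   Context: $T>0$ is fixed. Fractional Brownian motion is the centered continuous Gaussian process with $B^H_0=0$ and $\mathbb E|B^H_t-B^H_s|^2=|t-s|^{2H}$. For a process $\xi=(\xi_t)_{0\le t\le T}$, $\omega_\xi(h)=\mathbb E\int_0^T|\xi_t-\xi_{(t-h)^+}|^2\,dt$ for $h>0$, with $(t-h)^+=\max\{t-h,0\}$. *)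

theory Defs
  imports "HOL-Probability.Probability"
begin

text \<open>
  Gaussian random variables may be degenerate (zero variance); the library's normal density
  with standard deviation 0 is identically 0, so that case is separated.
\<close>

definition gaussian_rv :: "'a measure \<Rightarrow> ('a \<Rightarrow> real) \<Rightarrow> bool" where
  "gaussian_rv M X \<longleftrightarrow>
     X \<in> borel_measurable M \<and>
     (\<exists>\<mu>. (AE w in M. X w = \<mu>) \<or>
          (\<exists>\<sigma>>0. distributed M lborel X (normal_density \<mu> \<sigma>)))"

definition gaussian_process_on ::
    "'a measure \<Rightarrow> real set \<Rightarrow> (real \<Rightarrow> 'a \<Rightarrow> real) \<Rightarrow> bool" where
  "gaussian_process_on M I X \<longleftrightarrow>
     (\<forall>J c. finite J \<longrightarrow> J \<subseteq> I \<longrightarrow> gaussian_rv M (\<lambda>w. \<Sum>t\<in>J. c t * X t w))"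

text \<open>
  Path continuity and the initial condition are only required almost surely.
  Values of the process outside \<open>{0..T}\<close> are irrelevant.
\<close>

definition fractional_brownian_motion ::
    "'a measure \<Rightarrow> real \<Rightarrow> real \<Rightarrow> (real \<Rightarrow> 'a \<Rightarrow> real) \<Rightarrow> bool" where
  "fractional_brownian_motion M T H B \<longleftrightarrow>
     prob_space M \<and>
     gaussian_process_on M {0..T} B \<and>
     (\<forall>t\<in>{0..T}. prob_space.expectation M (B t) = 0) \<and>
     (AE w in M. continuous_on {0..T} (\<lambda>t. B t w)) \<and>
     (AE w in M. B 0 w = 0) \<and>
     (\<forall>s\<in>{0..T}. \<forall>t\<in>{0..T}.
        prob_space.expectation M (\<lambda>w. \<bar>B t w - B s w\<bar>\<^sup>2) = \<bar>t - s\<bar> powr (2 * H))"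

definition natural_filtration ::
    "'a measure \<Rightarrow> (real \<Rightarrow> 'a \<Rightarrow> real) \<Rightarrow> real \<Rightarrow> 'a measure" where
  "natural_filtration M X t =
     sigma (space M) (\<Union>s\<in>{0..t}. {X s -` A \<inter> space M | A. A \<in> sets borel})"

definition translation_modulus ::
    "'a measure \<Rightarrow> real \<Rightarrow> (real \<Rightarrow> 'a \<Rightarrow> real) \<Rightarrow> real \<Rightarrow> ennreal" where
  "translation_modulus M T X h =
     (\<integral>\<^sup>+ w. (\<integral>\<^sup>+ t\<in>{0..T}. ennreal (\<bar>X t w - X (max (t - h) 0) w\<bar>\<^sup>2) \<partial>lborel) \<partial>M)"

text \<open>The square of the translation seminorm; possibly infinite.\<close>

definition translation_seminorm_sq ::
    "'a measure \<Rightarrow> real \<Rightarrow> (real \<Rightarrow> 'a \<Rightarrow> real) \<Rightarrow> ennreal" where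
  "translation_seminorm_sq M T X = (SUP h\<in>{0<..}. translation_modulus M T X h / ennreal h)"

end

theory Submission
  imports Defs
begin

text \<open>
  By Tonelli, the modulus is the integral over \<open>t \<in> [0,T]\<close> of the second moment of the
  increment over \<open>[(t - h)\<^sup>+, t]\<close>, that is of \<open>(min t h)\<close> to the power \<open>2H\<close>; it is constant
  for \<open>h \<ge> T\<close>, so only \<open>h \<le> T\<close> matters for the supremum.  With \<open>a = 2H\<close>, the quotient
  \<open>T h\<^sup>a\<^sup>-\<^sup>1 - a/(a+1) h\<^sup>a\<close> blows up at 0 for \<open>a < 1\<close>, equals \<open>T - h/2\<close> for \<open>a = 1\<close>, and for
  \<open>a > 1\<close> is maximised, by Young's inequality with weights \<open>(a-1)/a\<close> and \<open>1/a\<close>, at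
  \<open>h = T (1 - 1/a\<^sup>2)\<close>.
\<close>

section \<open>Joint measurability and Tonelli for processes with continuous paths\<close>

text \<open>By path continuity \<open>X\<close> is the pointwise limit of the step processes
  \<open>u n\<close>, which sample \<open>X\<close> at the grid point of mesh
  \<open>1 / Suc n\<close> just below \<open>t\<close>.\<close>

lemma continuous_paths_measurable_pair:
  fixes X :: "real \<Rightarrow> 'a \<Rightarrow> real"
  assumes meas: "\<And>t. X t \<in> borel_measurable M"
    and cont: "\<And>w. w \<in> space M \<Longrightarrow> continuous_on UNIV (\<lambda>t. X t w)"
  shows "(\<lambda>(w, t). X t w) \<in> borel_measurable (M \<Otimes>\<^sub>M borel)"
proof (rule borel_measurable_LIMSEQ_real)
  define u where "u n p = X (of_int \<lfloor>real (Suc n) * snd p\<rfloor> / real (Suc n)) (fst p)"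
    for n and p :: "'a \<times> real"
  show "u n \<in> borel_measurable (M \<Otimes>\<^sub>M borel)" for n
    unfolding u_def
  \<comment> \<open>The floor takes countably many values, and once it is fixed only the measurable
    variable \<open>X\<close> at a single time remains.\<close>
  proof (rule measurable_compose_countable[where g = "\<lambda>p. \<lfloor>real (Suc n) * snd p\<rfloor>"])
    show "(\<lambda>p. X (of_int i / real (Suc n)) (fst p)) \<in> borel_measurable (M \<Otimes>\<^sub>M borel)" for i :: int
      using measurable_compose[OF measurable_fst meas] .
  qed measurable
  show "(\<lambda>n. u n p) \<longlonglongrightarrow> (case p of (w, t) \<Rightarrow> X t w)" if "p \<in> space (M \<Otimes>\<^sub>M borel)" for p
  proof -
    obtain w t where p: "p = (w, t)" by (cases p)
    with that have w: "w \<in> space M" by (simp add: space_pair_measure)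
    have "(\<lambda>n. of_int \<lfloor>real (Suc n) * t\<rfloor> / real (Suc n)) \<longlonglongrightarrow> t"
    proof (rule tendsto_sandwich[of "\<lambda>n. t - 1 / real (Suc n)" _ _ "\<lambda>_. t"])
      show "\<forall>\<^sub>F n in sequentially. t - 1 / real (Suc n) \<le> of_int \<lfloor>real (Suc n) * t\<rfloor> / real (Suc n)"
      proof (rule always_eventually, rule allI)
        fix n
        have "real (Suc n) * t - 1 \<le> of_int \<lfloor>real (Suc n) * t\<rfloor>" by linarith
        then have "(real (Suc n) * t - 1) / real (Suc n) \<le> of_int \<lfloor>real (Suc n) * t\<rfloor> / real (Suc n)"
          by (intro divide_right_mono) auto
        then show "t - 1 / real (Suc n) \<le> of_int \<lfloor>real (Suc n) * t\<rfloor> / real (Suc n)"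
          by (simp add: diff_divide_distrib del: of_nat_Suc)
      qed
      show "\<forall>\<^sub>F n in sequentially. of_int \<lfloor>real (Suc n) * t\<rfloor> / real (Suc n) \<le> t"
        by (rule always_eventually)
          (simp add: pos_divide_le_eq mult.commute of_int_floor_le del: of_nat_Suc)
      have "(\<lambda>n. t - 1 / real (Suc n)) \<longlonglongrightarrow> t - 0"
        by (intro tendsto_diff tendsto_const LIMSEQ_inverse_real_of_nat[unfolded inverse_eq_divide])
      then show "(\<lambda>n. t - 1 / real (Suc n)) \<longlonglongrightarrow> t" by simp
    qed simp
    then have "(\<lambda>n. X (of_int \<lfloor>real (Suc n) * t\<rfloor> / real (Suc n)) w) \<longlonglongrightarrow> X t w"
      using continuous_on_tendsto_compose[OF cont[OF w]] by simp
    then show ?thesis by (simp add: p u_def)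
  qed
qed

text \<open>Tonelli needs joint measurability, while the paths are continuous only almost surely and
  only on \<open>{0..T}\<close>. The exchange is made for a regularised process \<open>Y\<close> and
  carried back to \<open>X\<close>.\<close>

lemma translation_modulus_Tonelli:
  fixes X :: "real \<Rightarrow> 'a \<Rightarrow> real"
  assumes M: "sigma_finite_measure M" and T: "0 \<le> T" and h: "0 \<le> h"
    and meas: "\<And>t. t \<in> {0..T} \<Longrightarrow> X t \<in> borel_measurable M"
    and cont: "AE w in M. continuous_on {0..T} (\<lambda>t. X t w)"
  shows "translation_modulus M T X h =
    (\<integral>\<^sup>+ t\<in>{0..T}. (\<integral>\<^sup>+ w. ennreal (\<bar>X t w - X (max (t - h) 0) w\<bar>\<^sup>2) \<partial>M) \<partial>lborel)"
proof -
  interpret M: sigma_finite_measure M by (rule M)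
  interpret pair_sigma_finite M lborel ..
  obtain N where N: "{w \<in> space M. \<not> continuous_on {0..T} (\<lambda>t. X t w)} \<subseteq> N"
    "emeasure M N = 0" "N \<in> sets M"
    using AE_E[OF cont] by auto
  \<comment> \<open>Zeroing the paths on the null set \<open>N\<close> and clamping time to
    \<open>{0..T}\<close> makes every path continuous on the whole line.\<close>
  define Y where "Y t w = indicator (space M - N) w * X (min (max t 0) T) w" for t w
  have Y_X: "Y t w = X t w" if "w \<in> space M - N" "t \<in> {0..T}" for t w
    using that by (auto simp: Y_def min_def max_def)
  have AE_N: "AE w in M. w \<in> space M - N"
    using N by (intro AE_I[of _ _ N]) auto
  have Y_meas: "(\<lambda>(w, t). Y t w) \<in> borel_measurable (M \<Otimes>\<^sub>M borel)"
  proof (rule continuous_paths_measurable_pair)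
    fix t
    have "X (min (max t 0) T) \<in> borel_measurable M" using T by (intro meas) auto
    then show "Y t \<in> borel_measurable M" unfolding Y_def using N by measurable
  next
    fix w assume w: "w \<in> space M"
    show "continuous_on UNIV (\<lambda>t. Y t w)"
    proof (cases "w \<in> N")
      case False
      with N w have "continuous_on {0..T} (\<lambda>t. X t w)" by auto
      then have "continuous_on UNIV (\<lambda>t. X (min (max t 0) T) w)"
        by (rule continuous_on_compose2) (use T in \<open>auto intro!: continuous_intros\<close>)
      then show ?thesis using False w by (simp add: Y_def)
    qed (simp add: Y_def)
  qed
  \<comment> \<open>A general measurable time \<open>f\<close> covers both \<open>t\<close> and the
    translated time \<open>max (t - h) 0\<close>.\<close>
  have [measurable]: "(\<lambda>p. Y (f p) (fst p)) \<in> borel_measurable (M \<Otimes>\<^sub>M lborel)"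
    if "f \<in> borel_measurable (M \<Otimes>\<^sub>M lborel)" for f
  proof -
    have "(\<lambda>p. (fst p, f p)) \<in> M \<Otimes>\<^sub>M lborel \<rightarrow>\<^sub>M M \<Otimes>\<^sub>M borel"
      using that by measurable
    from measurable_compose[OF this Y_meas] show ?thesis by simp
  qed
  have "translation_modulus M T X h =
    (\<integral>\<^sup>+ w. (\<integral>\<^sup>+ t\<in>{0..T}. ennreal (\<bar>Y t w - Y (max (t - h) 0) w\<bar>\<^sup>2) \<partial>lborel) \<partial>M)"
    unfolding translation_modulus_def
  proof (rule nn_integral_cong_AE, use AE_N in eventually_elim)
    case (elim w)
    \<comment> \<open>For \<open>t\<close> in \<open>{0..T}\<close> and \<open>0 \<le> h\<close> the
      translated time is again in \<open>{0..T}\<close>, so \<open>Y\<close> agrees with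
      \<open>X\<close> at both times.\<close>
    show ?case
      by (intro nn_integral_cong) (use elim h in \<open>auto simp: indicator_def Y_X\<close>)
  qed
  also have "\<dots> = (\<integral>\<^sup>+ t. (\<integral>\<^sup>+ w. ennreal (\<bar>Y t w - Y (max (t - h) 0) w\<bar>\<^sup>2) * indicator {0..T} t \<partial>M) \<partial>lborel)"
    by (rule Fubini'[symmetric]) (unfold split_beta', measurable)
  also have "\<dots> = (\<integral>\<^sup>+ t\<in>{0..T}. (\<integral>\<^sup>+ w. ennreal (\<bar>X t w - X (max (t - h) 0) w\<bar>\<^sup>2) \<partial>M) \<partial>lborel)"
  proof (rule nn_integral_cong)
    fix t
    show "(\<integral>\<^sup>+ w. ennreal (\<bar>Y t w - Y (max (t - h) 0) w\<bar>\<^sup>2) * indicator {0..T} t \<partial>M) =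
      (\<integral>\<^sup>+ w. ennreal (\<bar>X t w - X (max (t - h) 0) w\<bar>\<^sup>2) \<partial>M) * indicator {0..T} t"
    proof (cases "t \<in> {0..T}")
      case True
      have "(\<integral>\<^sup>+ w. ennreal (\<bar>Y t w - Y (max (t - h) 0) w\<bar>\<^sup>2) \<partial>M) =
        (\<integral>\<^sup>+ w. ennreal (\<bar>X t w - X (max (t - h) 0) w\<bar>\<^sup>2) \<partial>M)"
        by (rule nn_integral_cong_AE, use AE_N in eventually_elim) (use True h in \<open>auto simp: Y_X\<close>)
      then show ?thesis using True by simp
    qed simp
  qed
  finally show ?thesis .
qed

section \<open>Increments of fractional Brownian motion and their time integral\<close>

lemma fractional_brownian_motion_measurable:
  assumes "fractional_brownian_motion M T H B" "t \<in> {0..T}"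
  shows "B t \<in> borel_measurable M"
proof -
  have "gaussian_process_on M {0..T} B"
    using assms(1) by (simp add: fractional_brownian_motion_def)
  then have "gaussian_rv M (\<lambda>w. \<Sum>s\<in>{t}. 1 * B s w)"
    using assms(2) unfolding gaussian_process_on_def
    by (elim allE[of _ "{t}"] allE[of _ "\<lambda>_. 1"]) auto
  then show ?thesis by (simp add: gaussian_rv_def)
qed

lemma fractional_brownian_motion_nn_integral_increment:
  assumes B: "fractional_brownian_motion M T H B" and st: "s \<in> {0..T}" "t \<in> {0..T}"
  shows "(\<integral>\<^sup>+ w. ennreal (\<bar>B t w - B s w\<bar>\<^sup>2) \<partial>M) = ennreal (\<bar>t - s\<bar> powr (2 * H))"
proof (cases "s = t")
  case False
  have E: "integral\<^sup>L M (\<lambda>w. \<bar>B t w - B s w\<bar>\<^sup>2) = \<bar>t - s\<bar> powr (2 * H)"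
    using B st by (simp add: fractional_brownian_motion_def)
  \<comment> \<open>The Bochner integral of a non-integrable function is 0, whereas this one is positive.\<close>
  have "integrable M (\<lambda>w. \<bar>B t w - B s w\<bar>\<^sup>2)"
    by (rule ccontr) (use E False not_integrable_integral_eq in fastforce)
  from nn_integral_eq_integral[OF this] E show ?thesis by simp
qed simp

text \<open>The integrand is a pure power on \<open>{0..h}\<close> and constant on
  \<open>{h..T}\<close>; the two integrals add up.\<close>

lemma nn_integral_min_powr:
  assumes h: "0 < h" "h \<le> T" and a: "0 < (a::real)"
  shows "(\<integral>\<^sup>+ t\<in>{0..T}. ennreal (min t h powr a) \<partial>lborel) =
    ennreal (T * h powr a - a / (a + 1) * h powr (a + 1))"
proof -
  have "((\<lambda>t. t powr a) has_integral h powr (a + 1) / (a + 1)) {0..h}"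
    using has_integral_powr_from_0[of a h] h a by simp
  then have 1: "((\<lambda>t. min t h powr a) has_integral h powr (a + 1) / (a + 1)) {0..h}"
    by (rule has_integral_eq[rotated]) (auto simp: min_def)
  have "((\<lambda>t. h powr a) has_integral (T - h) * h powr a) {h..T}"
    using has_integral_const_real[of "h powr a" h T] h by simp
  then have 2: "((\<lambda>t. min t h powr a) has_integral (T - h) * h powr a) {h..T}"
    by (rule has_integral_eq[rotated]) (auto simp: min_def)
  have "h powr (a + 1) / (a + 1) + (T - h) * h powr a = T * h powr a - a / (a + 1) * h powr (a + 1)"
    using h a by (simp add: powr_add field_simps)
  with has_integral_combine[OF _ _ 1 2] h
  have "((\<lambda>t. min t h powr a) has_integral T * h powr a - a / (a + 1) * h powr (a + 1)) {0..T}"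
    by simp
  then show ?thesis by (intro nn_integral_has_integral_lebesgue') auto
qed

lemma fractional_brownian_motion_translation_modulus:
  assumes B: "fractional_brownian_motion M T H B" and "0 < T" "0 < H" "0 < h"
  shows "translation_modulus M T B h =
    ennreal (T * min h T powr (2 * H) - 2 * H / (2 * H + 1) * min h T powr (2 * H + 1))"
proof -
  have M: "prob_space M" and cont: "AE w in M. continuous_on {0..T} (\<lambda>t. B t w)"
    using B by (simp_all add: fractional_brownian_motion_def)
  interpret prob_space M by (rule M)
  have "translation_modulus M T B h =
    (\<integral>\<^sup>+ t\<in>{0..T}. (\<integral>\<^sup>+ w. ennreal (\<bar>B t w - B (max (t - h) 0) w\<bar>\<^sup>2) \<partial>M) \<partial>lborel)"
    using assms cont
    by (intro translation_modulus_Tonelli fractional_brownian_motion_measurable[OF B])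
      (auto intro: sigma_finite_measure_axioms)
  also have "\<dots> = (\<integral>\<^sup>+ t\<in>{0..T}. ennreal (min t (min h T) powr (2 * H)) \<partial>lborel)"
  proof (rule nn_integral_cong)
    fix t
    show "(\<integral>\<^sup>+ w. ennreal (\<bar>B t w - B (max (t - h) 0) w\<bar>\<^sup>2) \<partial>M) * indicator {0..T} t =
      ennreal (min t (min h T) powr (2 * H)) * indicator {0..T} t"
    proof (cases "t \<in> {0..T}")
      case True
      \<comment> \<open>The increment covers all of \<open>[0, t]\<close> if \<open>t < h\<close>
        and has length \<open>h\<close> otherwise. The extra cap at \<open>T\<close> is harmless
        since \<open>t \<le> T\<close>, and lets \<open>nn_integral_min_powr\<close> apply to lags
        beyond \<open>T\<close>.\<close>
      then have "\<bar>t - max (t - h) 0\<bar> = min t (min h T)" using assms by auto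
      then show ?thesis
        using fractional_brownian_motion_nn_integral_increment[OF B, of "max (t - h) 0" t] True assms
        by simp
    qed simp
  qed
  also have "\<dots> = ennreal (T * min h T powr (2 * H) - 2 * H / (2 * H + 1) * min h T powr (2 * H + 1))"
    using assms by (intro nn_integral_min_powr) auto
  finally show ?thesis .
qed

section \<open>Maximising the real profile of the quotient\<close>

text \<open>The scale \<open>k\<close> is the critical point of the profile. Measured in units of
  \<open>k\<close>, the profile is a constant times a function of \<open>x\<close> free of
  \<open>T\<close>, whose maximum \<open>1 / a\<close> is at \<open>x = 1\<close>.\<close>

lemma powr_profile_rescaled:
  fixes a T x :: real
  assumes a: "1 < a" and T: "0 < T" and x: "0 < x"
  defines "k \<equiv> T * (1 - 1 / a\<^sup>2)"
  shows "T * (k * x) powr (a - 1) - a / (a + 1) * (k * x) powr a =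
    T powr a * (1 - 1 / a\<^sup>2) powr (a - 1) * (x powr (a - 1) - (a - 1) / a * x powr a)"
proof -
  have pos: "0 < 1 - 1 / a\<^sup>2" using a by (simp add: power2_eq_square less_1_mult)
  then have k: "0 < k" using T by (simp add: k_def)
  \<comment> \<open>Since \<open>1 - 1 / a\<^sup>2 = (a - 1) * (a + 1) / a\<^sup>2\<close>, the
    factor \<open>a + 1\<close> cancels and \<open>T\<close> comes out of both terms.\<close>
  have coef: "a / (a + 1) * k = T * ((a - 1) / a)"
    using a by (simp add: k_def divide_simps power2_eq_square) (simp add: algebra_simps)
  have "k powr a = k powr (a - 1) * k" using k by (simp add: powr_diff)
  then have "T * (k * x) powr (a - 1) - a / (a + 1) * (k * x) powr a =
    T * k powr (a - 1) * x powr (a - 1) - (a / (a + 1) * k) * k powr (a - 1) * x powr a"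
    using k x by (simp add: powr_mult)
  also have "\<dots> = T * k powr (a - 1) * (x powr (a - 1) - (a - 1) / a * x powr a)"
    unfolding coef by (simp add: algebra_simps)
  also have "T * k powr (a - 1) = T powr a * (1 - 1 / a\<^sup>2) powr (a - 1)"
    using T pos by (simp add: k_def powr_mult powr_diff)
  finally show ?thesis .
qed

lemma powr_profile_le:
  fixes a T h :: real
  assumes a: "1 < a" and T: "0 < T" and h: "0 < h"
  shows "T * h powr (a - 1) - a / (a + 1) * h powr a
    \<le> T powr a / a * (1 - 1 / a\<^sup>2) powr (a - 1)"
proof -
  define k where "k = T * (1 - 1 / a\<^sup>2)"
  have "0 < 1 - 1 / a\<^sup>2" using a by (simp add: power2_eq_square less_1_mult)
  then have k: "0 < k" using T by (simp add: k_def)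
  define x where "x = h / k"
  have x: "0 < x" "k * x = h" using h k by (auto simp: x_def)
  \<comment> \<open>Young's inequality for the numbers \<open>x powr a\<close> and \<open>1\<close>;
    the left side is \<open>x powr (a - 1)\<close>.\<close>
  have "(x powr a) powr ((a - 1) / a) * 1 powr (1 / a) \<le> (a - 1) / a * x powr a + 1 / a * 1"
    using a x by (intro Youngs_inequality_0) (auto simp: field_simps)
  then have "x powr (a - 1) - (a - 1) / a * x powr a \<le> 1 / a"
    using a by (simp add: powr_powr)
  then have "T powr a * (1 - 1 / a\<^sup>2) powr (a - 1) * (x powr (a - 1) - (a - 1) / a * x powr a)
    \<le> T powr a * (1 - 1 / a\<^sup>2) powr (a - 1) * (1 / a)"
    by (intro mult_left_mono) auto
  with powr_profile_rescaled[OF a T x(1), folded k_def, unfolded x(2)] show ?thesis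
    by simp
qed

lemma powr_profile_at_max:
  fixes a T :: real
  assumes a: "1 < a" and T: "0 < T"
  defines "k \<equiv> T * (1 - 1 / a\<^sup>2)"
  shows "T * k powr (a - 1) - a / (a + 1) * k powr a = T powr a / a * (1 - 1 / a\<^sup>2) powr (a - 1)"
proof -
  have "1 - (a - 1) / a = 1 / a" using a by (simp add: field_simps)
  with powr_profile_rescaled[OF a T zero_less_one, folded k_def] show ?thesis
    by simp
qed

text \<open>For \<open>h \<le> T\<close> the subtracted term is at most the fraction
  \<open>a / (a + 1)\<close> of the first, so \<open>T * h powr (a - 1) / (a + 1)\<close> survives,
  and its exponent is negative.\<close>

lemma powr_profile_unbounded:
  fixes a T C :: real
  assumes a: "0 < a" "a < 1" and T: "0 < T"
  obtains h where "0 < h" "h \<le> T" "C \<le> T * h powr (a - 1) - a / (a + 1) * h powr a"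
proof -
  \<comment> \<open>The second argument solves
    \<open>T * h powr (a - 1) = max C 1 * (a + 1)\<close>. A smaller \<open>h\<close> only increases
    the power, so truncation at \<open>T\<close> is safe; \<open>max C 1\<close> keeps the base
    positive.\<close>
  define h where "h = min T ((max C 1 * (a + 1) / T) powr (1 / (a - 1)))"
  let ?q = "(max C 1 * (a + 1) / T)"
  have q: "0 < ?q" using a T by (intro divide_pos_pos mult_pos_pos) auto
  have h: "0 < h" "h \<le> T" using q T by (auto simp: h_def)
  have "?q = (?q powr (1 / (a - 1))) powr (a - 1)"
    using q a T by (simp add: powr_powr)
  also have "\<dots> \<le> h powr (a - 1)"
    using a h by (intro powr_mono2') (auto simp: h_def)
  finally have "max C 1 * (a + 1) \<le> T * h powr (a - 1)"
    using T by (simp add: divide_le_eq mult.commute)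
  moreover have "C * (a + 1) \<le> max C 1 * (a + 1)"
    using a by (intro mult_right_mono) auto
  ultimately have "C * (a + 1) \<le> T * h powr (a - 1)" by simp
  then have "C \<le> T * h powr (a - 1) / (a + 1)"
    using a by (simp add: le_divide_eq)
  also have "\<dots> = T * h powr (a - 1) - a / (a + 1) * T * h powr (a - 1)"
    using a by (simp add: field_simps)
  also have "\<dots> \<le> T * h powr (a - 1) - a / (a + 1) * h powr a"
  proof -
    have "h powr a = h * h powr (a - 1)" using h by (simp add: powr_diff)
    also have "\<dots> \<le> T * h powr (a - 1)" using h by (intro mult_right_mono) auto
    finally have "a / (a + 1) * h powr a \<le> a / (a + 1) * (T * h powr (a - 1))"
      using a by (intro mult_left_mono) auto
    then show ?thesis by simp
  qed
  finally show ?thesis using that h by blast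
qed

section \<open>The modulus and the supremum of its quotient in the three regimes of
  \<open>H\<close>\<close>

theorem lemma2p10:
  fixes M :: "'a measure" and T H :: real
    and B :: "real \<Rightarrow> 'a \<Rightarrow> real" and F :: "real \<Rightarrow> 'a measure"
  assumes "0 < T" and "0 < H" and "H < 1"
    and "fractional_brownian_motion M T H B"
    and "\<And>t. t \<in> {0..T} \<Longrightarrow> F t = natural_filtration M B t"
  shows "(\<forall>h. 0 < h \<and> h \<le> T \<longrightarrow>
            translation_modulus M T B h =
              ennreal (T * h powr (2 * H) - 2 * H / (2 * H + 1) * h powr (2 * H + 1))) \<and>
         translation_seminorm_sq M T B =
           (SUP h\<in>{0<..}. translation_modulus M T B h / ennreal h) \<and>
         (SUP h\<in>{0<..}. translation_modulus M T B h / ennreal h) =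
           (if H < 1 / 2 then \<infinity>
            else if H = 1 / 2 then ennreal T
            else ennreal (T powr (2 * H) / (2 * H) * (1 - 1 / (4 * H\<^sup>2)) powr (2 * H - 1)))"
proof -
  define a where "a = 2 * H"
  have a: "0 < a" using assms by (simp add: a_def)
  let ?q = "\<lambda>h. translation_modulus M T B h / ennreal h"
  define g where "g h = T * h powr (a - 1) - a / (a + 1) * h powr a" for h
  have modulus: "translation_modulus M T B h =
      ennreal (T * min h T powr a - a / (a + 1) * min h T powr (a + 1))" if "0 < h" for h
    using fractional_brownian_motion_translation_modulus[OF assms(4,1,2) that] by (simp add: a_def)
  have quotient: "?q h = ennreal (g h)" if "0 < h" "h \<le> T" for h
  proof -
    have eq: "T * h powr a - a / (a + 1) * h powr (a + 1) = h * g h"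
      using that by (simp add: g_def powr_diff powr_add algebra_simps)
    \<comment> \<open>Nonnegativity of \<open>g h\<close> is checked because \<open>ennreal\<close>
      sends negative reals to 0 and would not commute with the division.\<close>
    have "a / (a + 1) * h powr a \<le> 1 * h powr a"
      using a by (intro mult_right_mono) auto
    also have "\<dots> = h * h powr (a - 1)" using that by (simp add: powr_diff)
    also have "\<dots> \<le> T * h powr (a - 1)" using that by (intro mult_right_mono) auto
    finally have "0 \<le> g h" by (simp add: g_def)
    then have "0 \<le> h * g h" using that by simp
    moreover have "translation_modulus M T B h = ennreal (h * g h)"
      using that modulus[of h] eq by (simp only: min_absorb1)
    ultimately show ?thesis using that by (simp add: divide_ennreal)
  qed
  \<comment> \<open>Beyond \<open>T\<close> the modulus is constant while the denominator
    grows.\<close>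
  have quotient_le: "?q h \<le> ?q (min h T)" if "0 < h" for h
    using that assms(1) by (auto simp: modulus min_def divide_ennreal_def inverse_ennreal
        intro!: mult_left_mono ennreal_leI le_imp_inverse_le)
  have g_le_Sup: "ennreal (g h) \<le> (SUP h\<in>{0<..}. ?q h)" if "0 < h" "h \<le> T" for h
    using that by (subst quotient[symmetric]) (auto intro: SUP_upper)
  have Sup_le: "(SUP h\<in>{0<..}. ?q h) \<le> ennreal C" if "\<And>h. 0 < h \<Longrightarrow> h \<le> T \<Longrightarrow> g h \<le> C" for C
  proof (rule SUP_least)
    fix h :: real assume "h \<in> {0<..}"
    then have h: "0 < h" "0 < min h T" using assms by auto
    have "?q h \<le> ?q (min h T)" using h by (intro quotient_le)
    also have "\<dots> = ennreal (g (min h T))" using h by (intro quotient) auto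
    also have "\<dots> \<le> ennreal C" using h by (intro ennreal_leI that) auto
    finally show "?q h \<le> ennreal C" .
  qed
  have Sup: "(SUP h\<in>{0<..}. ?q h) =
    (if H < 1 / 2 then \<infinity> else if H = 1 / 2 then ennreal T
     else ennreal (T powr a / a * (1 - 1 / a\<^sup>2) powr (a - 1)))"
  proof -
    consider "H < 1 / 2" | "H = 1 / 2" | "1 / 2 < H" by linarith
    then show ?thesis
    proof cases
      case 1
      have "(SUP h\<in>{0<..}. ?q h) = top"
      proof (rule ennreal_SUP_eq_top)
        fix n :: nat
        obtain h where h: "0 < h" "h \<le> T" "real n \<le> g h"
          using powr_profile_unbounded[of a T "real n"] a 1 assms(1) unfolding g_def a_def by auto
        then have "ennreal (real n) \<le> ?q h" by (subst quotient) (auto intro: ennreal_leI)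
        then show "\<exists>h\<in>{0<..}. of_nat n \<le> ?q h"
          using h by (auto simp: ennreal_of_nat_eq_real_of_nat)
      qed
      with 1 show ?thesis by simp
    next
      case 2
      have g: "g h = T - h / 2" if "0 < h" for h
        using that by (simp add: g_def a_def 2)
      have "(SUP h\<in>{0<..}. ?q h) \<le> ennreal T" by (rule Sup_le) (simp add: g)
      moreover have "ennreal T \<le> (SUP h\<in>{0<..}. ?q h)"
      \<comment> \<open>The value \<open>T\<close> is only approached as \<open>h\<close> tends to
        0, hence the argument with \<open>e\<close>; \<open>h \<le> e\<close> makes the loss
        \<open>h / 2\<close> smaller than \<open>e\<close>.\<close>
      proof (rule ennreal_le_epsilon)
        fix e :: real assume e: "0 < e"
        define h where "h = min T e"
        have h: "0 < h" "h \<le> T" "h \<le> e" using e assms by (auto simp: h_def)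
        have "ennreal T \<le> ennreal (g h + e)" using h by (intro ennreal_leI) (simp add: g)
        also have "\<dots> = ennreal (g h) + ennreal e"
          using h e assms by (intro ennreal_plus) (auto simp: g)
        also have "\<dots> \<le> (SUP h\<in>{0<..}. ?q h) + ennreal e"
          using h by (intro add_right_mono g_le_Sup)
        finally show "ennreal T \<le> (SUP h\<in>{0<..}. ?q h) + ennreal e" .
      qed
      ultimately show ?thesis using 2 by simp
    next
      case 3
      then have a1: "1 < a" by (simp add: a_def)
      let ?v = "T powr a / a * (1 - 1 / a\<^sup>2) powr (a - 1)"
      define k where "k = T * (1 - 1 / a\<^sup>2)"
      have "0 < 1 - 1 / a\<^sup>2" using a1 by (simp add: power2_eq_square less_1_mult)
      \<comment> \<open>The bound \<open>k \<le> T\<close> places the maximiser in the range where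
        the quotient equals \<open>g\<close>, so the supremum is attained.\<close>
      then have k: "0 < k" "k \<le> T" using assms(1) by (auto simp: k_def mult_le_cancel_left2)
      have "(SUP h\<in>{0<..}. ?q h) \<le> ennreal ?v"
        unfolding g_def by (intro Sup_le) (use powr_profile_le[OF a1 assms(1)] in \<open>simp add: g_def\<close>)
      moreover have "g k = ?v"
        using powr_profile_at_max[OF a1 assms(1)] by (simp add: g_def k_def)
      ultimately show ?thesis using 3 g_le_Sup[OF k] by simp
    qed
  qed
  show ?thesis
    using Sup modulus by (auto simp: a_def translation_seminorm_sq_def power_mult_distrib min_absorb1)
qed

end
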